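(* Let $C$ be a small category equipped with a size functor $\lambda\colon C\to\mathbb{N}$. (1) If $C$ (with $\lambda$) is a Levi category, then $C$ (with $\lambda$) is a generalized higher rank $1$-graph. (2) If $C$ (with $\lambda$) is a generalized higher rank $1$-graph, then $C$ (with $\lambda$) is a Levi category.
   Context: A small category $C$ is regarded as its set of arrows, with identities identified with objects; the product $xy$ exists if and only if $\mathbf{d}(x)=\mathbf{r}(y)$, where $\mathbf{d}(x)$ and $\mathbf{r}(x)$ are the identities with $x\mathbf{d}(x)$ and $\mathbf{r}(x)x$ defined. An element $x$ is invertible if there is $x^{-1}\in C$ with $x^{-1}x=\mathbf{d}(x)$ and $xx^{-1}=\mathbf{r}(x)$. $\mathbb{N}=\{0,1,2,\dots\}$ is the additive monoid regarded as a one-object category. A size functor $\lambda\colon C\to\mathbb{N}$ is a functor (so $\lambda(xy)=\lambda(x)+\lambda(y)$ whenever $xy$ exists, and $\lambda(e)=0$ for identities $e$) such that $\lambda^{-1}(0)$ consists of all and only the invertible elements of $C$. An element $a$ is an atom if $a$ is noninvertible and whenever $a=bc$, either $b$ or $c$ is invertible. A category $C$ is equidivisible if $ab=cd$ implies either that there is $u\in C$ with $a=cu$ and $d=ub$, or that there is $v\in C$ with $c=av$ and $b=vd$. A Levi category is an equidivisible category equipped with a size functor $\lambda\colon C\to\mathbb{N}$ such that $\lambda^{-1}(1)$ consists of all and only the atoms of $C$. A size functor $\lambda$ satisfies the Weak Factorization Property (WFP) if: whenever $\lambda(a)=m+n$, there exist $a_1,a_2\in C$ with $a=a_1a_2$,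 $\lambda(a_1)=m$, $\lambda(a_2)=n$, such that if $a=b_1b_2$ with $\lambda(b_1)=m$ and $\lambda(b_2)=n$ then $b_1=a_1g$ and $b_2=g^{-1}a_2$ for some invertible element $g$. A generalized higher rank $1$-graph is a small category equipped with a size functor to $\mathbb{N}$ satisfying the WFP. *)

theory Defs
  imports Main
begin

text \<open>
  A small category in its arrows-only presentation: \<open>C\<close> is the set of arrows and the identities
  are themselves arrows. The maps \<open>dm\<close> and \<open>rg\<close> are the domain and range maps (written \<open>d\<close> and
  \<open>r\<close> in the literature). Composition is a total HOL function whose value \<open>x \<cdot> y\<close> is meaningful
  only if \<open>dm x = rg y\<close>; this is why all notions below are stated via \<open>composable\<close> or
  \<open>is_product\<close>.
\<close>

locale small_category =
  fixes C :: "'a set"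
    and dm :: "'a \<Rightarrow> 'a"
    and rg :: "'a \<Rightarrow> 'a"
    and cmp :: "'a \<Rightarrow> 'a \<Rightarrow> 'a"  (infixl "\<cdot>" 70)
  assumes dm_closed: "x \<in> C \<Longrightarrow> dm x \<in> C"
    and rg_closed: "x \<in> C \<Longrightarrow> rg x \<in> C"
    and dm_dm: "x \<in> C \<Longrightarrow> dm (dm x) = dm x"
    and rg_dm: "x \<in> C \<Longrightarrow> rg (dm x) = dm x"
    and dm_rg: "x \<in> C \<Longrightarrow> dm (rg x) = rg x"
    and rg_rg: "x \<in> C \<Longrightarrow> rg (rg x) = rg x"
    and comp_closed: "\<lbrakk>x \<in> C; y \<in> C; dm x = rg y\<rbrakk> \<Longrightarrow> x \<cdot> y \<in> C"
    and dm_comp: "\<lbrakk>x \<in> C; y \<in> C; dm x = rg y\<rbrakk> \<Longrightarrow> dm (x \<cdot> y) = dm y"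
    and rg_comp: "\<lbrakk>x \<in> C; y \<in> C; dm x = rg y\<rbrakk> \<Longrightarrow> rg (x \<cdot> y) = rg x"
    and comp_dm: "x \<in> C \<Longrightarrow> x \<cdot> dm x = x"
    and rg_comp_self: "x \<in> C \<Longrightarrow> rg x \<cdot> x = x"
    and comp_assoc: "\<lbrakk>x \<in> C; y \<in> C; z \<in> C; dm x = rg y; dm y = rg z\<rbrakk>
                      \<Longrightarrow> (x \<cdot> y) \<cdot> z = x \<cdot> (y \<cdot> z)"
begin

definition identity :: "'a \<Rightarrow> bool" where
  "identity e \<longleftrightarrow> e \<in> C \<and> dm e = e \<and> rg e = e"

definition composable :: "'a \<Rightarrow> 'a \<Rightarrow> bool" where
  "composable x y \<longleftrightarrow> x \<in> C \<and> y \<in> C \<and> dm x = rg y"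

text \<open>The assertion \<open>a = xy\<close> for a partial operation: the product exists and equals \<open>a\<close>.\<close>

definition is_product :: "'a \<Rightarrow> 'a \<Rightarrow> 'a \<Rightarrow> bool" where
  "is_product a x y \<longleftrightarrow> composable x y \<and> a = x \<cdot> y"

definition is_inverse :: "'a \<Rightarrow> 'a \<Rightarrow> bool" where
  "is_inverse x y \<longleftrightarrow> is_product (dm x) y x \<and> is_product (rg x) x y"

definition invertible :: "'a \<Rightarrow> bool" where
  "invertible x \<longleftrightarrow> x \<in> C \<and> (\<exists>y\<in>C. is_inverse x y)"

definition atom :: "'a \<Rightarrow> bool" where
  "atom a \<longleftrightarrow> a \<in> C \<and> \<not> invertible a \<and>
     (\<forall>b c. is_product a b c \<longrightarrow> invertible b \<or> invertible c)"

definition equidivisible :: bool where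
  "equidivisible \<longleftrightarrow>
     (\<forall>a b c d. composable a b \<and> composable c d \<and> a \<cdot> b = c \<cdot> d \<longrightarrow>
        (\<exists>u\<in>C. is_product a c u \<and> is_product d u b) \<or>
        (\<exists>v\<in>C. is_product c a v \<and> is_product b v d))"

text \<open>By uniqueness, "the inverse \<open>g\<inverse>\<close>" in \<open>WFP\<close> below may be expressed relationally.\<close>

lemma is_inverse_unique:
  assumes "is_inverse x y" "is_inverse x z"
  shows "y = z"
proof -
  have h: "x \<in> C" "y \<in> C" "z \<in> C" "dm y = rg x" "dm x = rg y" "dm x = rg z" "dm z = rg x"
      "dm x = y \<cdot> x" "rg x = x \<cdot> z"
    using assms by (auto simp: is_inverse_def is_product_def composable_def)
  have "y = y \<cdot> (x \<cdot> z)" using comp_dm[of y] h by metis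
  also have "\<dots> = (y \<cdot> x) \<cdot> z" using h comp_assoc[of y x z] by metis
  also have "\<dots> = z" using rg_comp_self[of z] h by metis
  finally show ?thesis .
qed

end

text \<open>
  The values of \<open>sz\<close> off \<open>C\<close> are irrelevant. The first two axioms are functoriality into the
  additive monoid of natural numbers.
\<close>

locale sized_category = small_category C dm rg cmp
  for C :: "'a set"
    and dm :: "'a \<Rightarrow> 'a"
    and rg :: "'a \<Rightarrow> 'a"
    and cmp :: "'a \<Rightarrow> 'a \<Rightarrow> 'a"  (infixl "\<cdot>" 70) +
  fixes sz :: "'a \<Rightarrow> nat"
  assumes sz_comp: "composable x y \<Longrightarrow> sz (x \<cdot> y) = sz x + sz y"
    and sz_identity: "identity e \<Longrightarrow> sz e = 0"
    and sz_zero_iff: "x \<in> C \<Longrightarrow> sz x = 0 \<longleftrightarrow> invertible x"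
begin

definition WFP :: bool where
  "WFP \<longleftrightarrow>
     (\<forall>a\<in>C. \<forall>m n. sz a = m + n \<longrightarrow>
        (\<exists>a\<^sub>1\<in>C. \<exists>a\<^sub>2\<in>C. is_product a a\<^sub>1 a\<^sub>2 \<and> sz a\<^sub>1 = m \<and> sz a\<^sub>2 = n \<and>
           (\<forall>b\<^sub>1 b\<^sub>2. is_product a b\<^sub>1 b\<^sub>2 \<and> sz b\<^sub>1 = m \<and> sz b\<^sub>2 = n \<longrightarrow>
              (\<exists>g g'. invertible g \<and> is_inverse g g' \<and>
                 is_product b\<^sub>1 a\<^sub>1 g \<and> is_product b\<^sub>2 g' a\<^sub>2))))"

end

locale levi_category = sized_category +
  assumes equidivisible: equidivisible
    and sz_one_iff: "a \<in> C \<Longrightarrow> sz a = 1 \<longleftrightarrow> atom a"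

locale generalized_higher_rank_1_graph = sized_category +
  assumes WFP: WFP

end

theory Submission
  imports Defs
begin

text \<open>
  From Levi to WFP, peeling atoms off the left one at a time yields factorizations of every
  prescribed size. If two factorizations of an element have the same sizes, the connecting
  element given by equidivisibility has size 0 and is therefore invertible. From WFP to Levi, the
  essentially unique factorizations of given sizes are connected by an invertible element; if
  \<open>ab = cd\<close> with \<open>\<lambda>(a) \<le> \<lambda>(c)\<close>, apply this to \<open>ab\<close> and \<open>c\<^sub>1(c\<^sub>2d)\<close>, where \<open>c = c\<^sub>1c\<^sub>2\<close> and
  \<open>\<lambda>(c\<^sub>1) = \<lambda>(a)\<close>.
\<close>

section \<open>Regrouping and cancellation in partial products\<close>

context small_category
begin

lemma is_product_closed:
  assumes "is_product a x y"
  shows "a \<in> C" "x \<in> C" "y \<in> C"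
  using assms comp_closed by (auto simp: is_product_def composable_def)

lemma is_product_assoc_right:
  assumes "is_product a b c" "is_product b p q"
  obtains r where "is_product a p r" "is_product r q c"
proof
  show "is_product a p (q \<cdot> c)" "is_product (q \<cdot> c) q c"
    using assms comp_closed comp_assoc[of p q c] dm_comp[of p q] rg_comp[of q c]
    by (auto simp: is_product_def composable_def)
qed

lemma is_product_assoc_left:
  assumes "is_product a b c" "is_product c p q"
  obtains r where "is_product a r q" "is_product r b p"
proof
  show "is_product a (b \<cdot> p) q" "is_product (b \<cdot> p) b p"
    using assms comp_closed comp_assoc[of b p q] dm_comp[of b p] rg_comp[of p q]
    by (auto simp: is_product_def composable_def)
qed

lemma is_product_functional:
  assumes "is_product a x y" "is_product b x y"
  shows "a = b"
  using assms by (simp add: is_product_def)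

lemma is_product_rg: "a \<in> C \<Longrightarrow> is_product a (rg a) a"
  by (simp add: is_product_def composable_def rg_closed dm_rg rg_comp_self)

lemma is_product_dm: "a \<in> C \<Longrightarrow> is_product a a (dm a)"
  by (simp add: is_product_def composable_def dm_closed rg_dm comp_dm)

lemma identity_rg: "a \<in> C \<Longrightarrow> identity (rg a)"
  by (simp add: identity_def rg_closed dm_rg rg_rg)

lemma is_inverse_sym:
  assumes "is_inverse x y"
  shows "is_inverse y x"
proof -
  have "x \<in> C" "y \<in> C" "dm x = rg y" "dm y = rg x"
    using assms by (auto simp: is_inverse_def is_product_def composable_def)
  then show ?thesis using assms unfolding is_inverse_def by metis
qed

lemma invertibleE:
  assumes "invertible g"
  obtains g' where "is_inverse g g'" "invertible g'"
  using assms is_inverse_sym unfolding invertible_def by blast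

text \<open>Put \<open>dm g = g' g\<close> in front of \<open>b\<close> and regroup:
  \<open>b = g' (g b)\<close>, where \<open>g b\<close> is \<open>a\<close>. The right-hand version
  is dual, with \<open>rg g = g g'\<close> placed after \<open>b\<close>.\<close>

lemma is_product_cancel_left:
  assumes "is_inverse g g'" "is_product a g b"
  shows "is_product b g' a"
proof -
  have g: "is_product (dm g) g' g" using assms(1) by (simp add: is_inverse_def)
  have "is_product b (dm g) b"
    using assms(2) is_product_rg[of b] unfolding is_product_def composable_def by metis
  from this g obtain r where "is_product b g' r" "is_product r g b"
    by (rule is_product_assoc_right)
  with assms(2) show ?thesis using is_product_functional by blast
qed

lemma is_product_cancel_right:
  assumes "is_inverse g g'" "is_product a b g"
  shows "is_product b a g'"
proof -
  have g: "is_product (rg g) g g'" using assms(1) by (simp add: is_inverse_def)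
  have "is_product b b (rg g)"
    using assms(2) is_product_dm[of b] unfolding is_product_def composable_def by metis
  from this g obtain r where "is_product b r g'" "is_product r b g"
    by (rule is_product_assoc_left)
  with assms(2) show ?thesis using is_product_functional by blast
qed

lemma equidivisibleD:
  assumes equidivisible "is_product x a b" "is_product x c d"
  shows "(\<exists>u. is_product a c u \<and> is_product d u b) \<or> (\<exists>v. is_product c a v \<and> is_product b v d)"
proof -
  have "composable a b \<and> composable c d \<and> a \<cdot> b = c \<cdot> d"
    using assms(2,3) by (simp add: is_product_def)
  then show ?thesis using assms(1)[unfolded equidivisible_def, rule_format, of a b c d] by blast
qed

end

section \<open>From the WFP to Levi categories\<close>

context sized_category
begin

lemma sz_product: "is_product a x y \<Longrightarrow> sz a = sz x + sz y"
  by (auto simp: is_product_def sz_comp)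

lemma WFP_factor:
  assumes WFP "a \<in> C" "sz a = m + n"
  obtains x y where "is_product a x y" "sz x = m" "sz y = n"
  using assms unfolding WFP_def by blast

text \<open>Both factorizations are compared with the distinguished one \<open>p q\<close>:
  \<open>a = p g\<close>, \<open>b = g' q\<close>, \<open>c = p h\<close>, \<open>d = h' q\<close>.
  Hence \<open>w = g' h\<close> serves on both sides.\<close>

lemma WFP_connect:
  assumes WFP "is_product x a b" "is_product x c d" "sz a = sz c" "sz b = sz d"
  obtains w where "is_product c a w" "is_product b w d"
proof -
  have "x \<in> C" "sz x = sz a + sz b"
    using assms is_product_closed sz_product by blast+
  with assms(1) obtain p q where
    *: "\<And>y z. \<lbrakk>is_product x y z; sz y = sz a; sz z = sz b\<rbrakk> \<Longrightarrow>
      \<exists>g g'. is_inverse g g' \<and> is_product y p g \<and> is_product z g' q"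
    unfolding WFP_def by metis
  obtain g g' where g: "is_inverse g g'" "is_product a p g" "is_product b g' q"
    using *[of a b] assms by auto
  obtain h h' where h: "is_inverse h h'" "is_product c p h" "is_product d h' q"
    using *[of c d] assms by auto
  have "is_product p a g'" using is_product_cancel_right g by blast
  with h(2) obtain w where w: "is_product c a w" "is_product w g' h"
    by (rule is_product_assoc_right)
  have "is_product q h d" using is_product_cancel_left is_inverse_sym h by blast
  with g(3) obtain w' where "is_product b w' d" "is_product w' g' h"
    by (rule is_product_assoc_left)
  \<comment> \<open>Both regroupings yield the same middle factor \<open>g' h\<close>, so
    \<open>w = w'\<close>.\<close>
  with w that show thesis using is_product_functional by blast
qed

text \<open>Comparing the sizes of the first factors selects the alternative in equidivisibility;
  exchanging the two factorizations gives the other one.\<close>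

lemma WFP_divide:
  assumes WFP "is_product x a b" "is_product x c d" "sz a \<le> sz c"
  obtains v where "is_product c a v" "is_product b v d"
proof -
  have "sz c = sz a + (sz c - sz a)" using assms(4) by simp
  with assms obtain c1 c2 where c: "is_product c c1 c2" "sz c1 = sz a"
    by (metis WFP_factor is_product_closed(2))
  from assms(3) c(1) obtain r where r: "is_product x c1 r" "is_product r c2 d"
    by (rule is_product_assoc_right)
  have "sz b = sz r"
    using sz_product[OF assms(2)] sz_product[OF r(1)] c(2) by simp
  with assms r c obtain w where w: "is_product c1 a w" "is_product b w r"
    by (metis WFP_connect)
  \<comment> \<open>The witness is \<open>v = w c2\<close>: \<open>c = (a w) c2\<close> and
    \<open>b = w (c2 d)\<close>.\<close>
  from c(1) w(1) obtain v where v: "is_product c a v" "is_product v w c2"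
    by (rule is_product_assoc_right)
  from w(2) r(2) obtain v' where "is_product b v' d" "is_product v' w c2"
    by (rule is_product_assoc_left)
  with v that show thesis using is_product_functional by blast
qed

lemma WFP_imp_equidivisible:
  assumes WFP
  shows equidivisible
  unfolding equidivisible_def
proof (intro allI impI, elim conjE)
  fix a b c d
  assume "composable a b" "composable c d" "a \<cdot> b = c \<cdot> d"
  then have p: "is_product (a \<cdot> b) a b" "is_product (a \<cdot> b) c d"
    by (simp_all add: is_product_def)
  show "(\<exists>u\<in>C. is_product a c u \<and> is_product d u b) \<or> (\<exists>v\<in>C. is_product c a v \<and> is_product b v d)"
  proof (cases "sz a \<le> sz c")
    case True
    from assms p True obtain v where "is_product c a v" "is_product b v d" by (rule WFP_divide)
    then show ?thesis using is_product_closed(3) by blast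
  next
    case False
    then have "sz c \<le> sz a" by simp
    with assms p(2,1) obtain u where "is_product a c u" "is_product d u b" by (rule WFP_divide)
    then show ?thesis using is_product_closed(3) by blast
  qed
qed

text \<open>If factor sizes sum to 1, one of them is 0. Conversely, the WFP splits a factor of size
  1 off an atom; this factor is noninvertible, so the cofactor is invertible and adds no
  size.\<close>

lemma WFP_imp_sz_one_iff_atom:
  assumes WFP "a \<in> C"
  shows "sz a = 1 \<longleftrightarrow> atom a"
proof
  assume one: "sz a = 1"
  have "invertible b \<or> invertible c" if "is_product a b c" for b c
  proof -
    have "sz b = 0 \<or> sz c = 0" using sz_product[OF that] one by auto
    then show ?thesis using is_product_closed[OF that] sz_zero_iff by blast
  qed
  then show "atom a" using assms(2) one sz_zero_iff[of a] by (auto simp: atom_def)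
next
  assume at: "atom a"
  then have "sz a \<noteq> 0" using assms(2) sz_zero_iff by (simp add: atom_def)
  \<comment> \<open>The truncated subtraction is exact because an atom has nonzero size.\<close>
  then have "sz a = 1 + (sz a - 1)" by simp
  with assms obtain x y where xy: "is_product a x y" "sz x = 1" "sz y = sz a - 1"
    by (metis WFP_factor)
  then have "invertible y"
    using at is_product_closed[OF xy(1)] sz_zero_iff[of x] by (auto simp: atom_def)
  then have "sz y = 0" using is_product_closed[OF xy(1)] sz_zero_iff by blast
  with xy sz_product show "sz a = 1" by fastforce
qed

end

section \<open>From Levi categories to the WFP\<close>

context levi_category
begin

text \<open>Strong induction on size. An atom is its own first factor; any other \<open>c\<close> is
  a product of two noninvertible elements, and the left one is strictly smaller because the right
  one has positive size.\<close>

lemma factor_one: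
  assumes "c \<in> C" "sz c \<noteq> 0"
  obtains x y where "is_product c x y" "sz x = 1"
proof -
  have "\<exists>x y. is_product c x y \<and> sz x = 1"
    using assms
  proof (induction "sz c" arbitrary: c rule: less_induct)
    case less
    show ?case
    proof (cases "atom c")
      case True
      then show ?thesis using less.prems is_product_dm sz_one_iff by blast
    next
      case False
      then obtain b d where bd: "is_product c b d" "\<not> invertible b" "\<not> invertible d"
        using less.prems sz_zero_iff[of c] unfolding atom_def by auto
      then have "sz b \<noteq> 0" "sz d \<noteq> 0"
        using is_product_closed sz_zero_iff by blast+
      moreover from this have "sz b < sz c" using sz_product[OF bd(1)] by simp
      ultimately obtain x y where xy: "is_product b x y" "sz x = 1"
        using less.hyps is_product_closed(2)[OF bd(1)] by blast
      then show ?thesis using is_product_assoc_right[OF bd(1)] by metis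
    qed
  qed
  with that show thesis by blast
qed

lemma factor:
  assumes "a \<in> C" "sz a = m + n"
  shows "\<exists>x y. is_product a x y \<and> sz x = m \<and> sz y = n"
  using assms(2)
proof (induction m arbitrary: n)
  case 0
  then show ?case using assms(1) is_product_rg identity_rg sz_identity by fastforce
next
  case (Suc m)
  \<comment> \<open>The induction hypothesis at \<open>Suc n\<close> leaves \<open>y\<close> of
    positive size, so an atom \<open>p\<close> can be moved from right to left:
    \<open>x (p q) = (x p) q\<close>.\<close>
  then obtain x y where xy: "is_product a x y" "sz x = m" "sz y = Suc n"
    by (metis add_Suc_shift)
  then obtain p q where pq: "is_product y p q" "sz p = 1"
    by (metis factor_one is_product_closed(3) nat.distinct(1))
  from xy(1) pq(1) obtain r where r: "is_product a r q" "is_product r x p"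
    by (rule is_product_assoc_left)
  then have "sz r = Suc m" "sz q = n"
    using sz_product[OF r(2)] sz_product[OF pq(1)] xy pq by simp_all
  with r(1) show ?case by blast
qed

lemma equal_size_factors:
  assumes "is_product x a b" "is_product x c d" "sz a = sz c"
  shows "\<exists>g g'. invertible g \<and> is_inverse g g' \<and> is_product c a g \<and> is_product d g' b"
  using equidivisibleD[OF equidivisible assms(1,2)]
proof (elim disjE exE conjE)
  fix u assume u: "is_product a c u" "is_product d u b"
  then have "invertible u"
    using sz_product[OF u(1)] assms(3) sz_zero_iff is_product_closed(3)[OF u(1)] by simp
  then obtain u' where "is_inverse u u'" "invertible u'" by (rule invertibleE)
  \<comment> \<open>Here \<open>a = c u\<close>, so the roles are reversed: \<open>g = u'\<close>
    and \<open>g' = u\<close>.\<close>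
  with u show ?thesis using is_inverse_sym is_product_cancel_right by blast
next
  fix v assume v: "is_product c a v" "is_product b v d"
  then have "invertible v"
    using sz_product[OF v(1)] assms(3) sz_zero_iff is_product_closed(3)[OF v(1)] by simp
  moreover from this obtain v' where "is_inverse v v'" by (rule invertibleE)
  ultimately show ?thesis using v is_product_cancel_left by blast
qed

lemma WFP: WFP
  unfolding WFP_def
proof (intro ballI allI impI)
  fix a m n assume "a \<in> C" "sz a = m + n"
  then obtain x y where "is_product a x y" "sz x = m" "sz y = n" using factor by blast
  \<comment> \<open>Any factorization with the prescribed sizes can serve as the distinguished
    one.\<close>
  then show "\<exists>a1\<in>C. \<exists>a2\<in>C. is_product a a1 a2 \<and> sz a1 = m \<and> sz a2 = n \<and>
      (\<forall>b1 b2. is_product a b1 b2 \<and> sz b1 = m \<and> sz b2 = n \<longrightarrow>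
        (\<exists>g g'. invertible g \<and> is_inverse g g' \<and> is_product b1 a1 g \<and> is_product b2 g' a2))"
    using equal_size_factors is_product_closed(2,3) by metis
qed

end

theorem theorem3p3:
  fixes C :: "'a set"
    and dm rg :: "'a \<Rightarrow> 'a"
    and cmp :: "'a \<Rightarrow> 'a \<Rightarrow> 'a"
    and sz :: "'a \<Rightarrow> nat"
  assumes "sized_category C dm rg cmp sz"
  shows "(levi_category C dm rg cmp sz \<longrightarrow> generalized_higher_rank_1_graph C dm rg cmp sz)
       \<and> (generalized_higher_rank_1_graph C dm rg cmp sz \<longrightarrow> levi_category C dm rg cmp sz)"
proof (intro conjI impI)
  assume "levi_category C dm rg cmp sz"
  then show "generalized_higher_rank_1_graph C dm rg cmp sz"
    by (intro generalized_higher_rank_1_graph.intro generalized_higher_rank_1_graph_axioms.intro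
        assms levi_category.WFP)
next
  interpret sized_category C dm rg cmp sz by (fact assms)
  assume "generalized_higher_rank_1_graph C dm rg cmp sz"
  then have WFP by (rule generalized_higher_rank_1_graph.WFP)
  \<comment> \<open>The size functor axioms come from the interpretation; equidivisibility and the
    atom condition remain.\<close>
  then show "levi_category C dm rg cmp sz"
    by unfold_locales (fact WFP_imp_equidivisible, rule WFP_imp_sz_one_iff_atom)
qed

end
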